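(* Let $X$ be a partially ordered normed space with ordering cone $\mathcal{C}$, and let $x_0\in A\subset X$. Assume that $A+\mathcal{C}$ is starshaped at $x_0$ and that $\mathcal{C}$ has a weakly compact base. If $(-\mathcal{C},\ \overline{\mathrm{cone}}(A-x_0+\mathcal{C}))$ has the strict separation property (SSP), then $x_0$ is a tangentially Borwein proper efficient point of $A$ (i.e. $x_0\in\mathrm{TBo}(A,\mathcal{C})$) if and only if there exists $(f,\alpha)\in\mathcal{C}^{a\#}_+$ such that $\min_{x\in A}\{f(x-x_0)+\alpha\|x-x_0\|\}$ is attained only at $x_0$.
   Context: $X$ is a real normed space with origin $0_X$, dual $X^*$ and unit sphere $S_X$. For $S\subset X$: $\overline S$ is the closure, $\mathrm{bd}(S)$ the boundary, $\mathrm{co}(S)$ the convex hull, $S_0:=S\cup\{0_X\}$, $\mathrm{cone}(S):=\{\lambda s:\lambda\ge0,\ s\in S\}$ and $\overline{\mathrm{cone}}(S)$ is its closure. A cone is a set closed under multiplication by all $\lambda\ge0$; all cones considered are assumed non-trivial (different from $\{0_X\}$ and $X$). A partially ordered normed space with ordering cone $\mathcal{C}$ is a normed space with a (non-trivial) convex cone $\mathcal{C}$ that is pointed, i.e. $(-\mathcal{C})\cap\mathcal{C}=\{0_X\}$. A base of a convex cone $\mathcal{C}$ is a non-empty convex $B\subset\mathcal{C}$ with $0_X\notin\overline B$ such that every $x\in\mathcal{C}\setminus\{0_X\}$ is uniquely of the form $x=\lambda b$ with $\lambda>0$, $b\in B$; $\mathcal{C}$ has a weakly compact base if some base is compact in the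 weak topology of $X$. A set $S$ is starshaped at $x_0\in S$ if $\lambda x+(1-\lambda)x_0\in S$ for all $x\in S$, $\lambda\in[0,1]$. For $\bar x\in\overline{S}$, the contingent cone is $T(S,\bar x):=\{\lim_n\lambda_n(x_n-\bar x):\lambda_n>0,\ x_n\in S,\ \lim_n x_n=\bar x\}$. $x_0\in\mathrm{TBo}(A,\mathcal{C})$ means $x_0\in A$ and $T(A+\mathcal{C},x_0)\cap(-\mathcal{C})=\{0_X\}$. For a cone $\mathcal{C}$, $\mathcal{C}_{\wedge}:=\mathrm{co}(\mathcal{C}\cap S_X)$ and $\mathcal{C}_{\vee}:=\mathrm{co}((\mathrm{bd}(\mathcal{C})\cap S_X)_0)$. The pair of cones $(\mathcal{C},\mathcal{K})$ has the strict separation property (SSP) if $0_X\notin\overline{\mathcal{C}_{\wedge}-\mathcal{K}_{\vee}}$ (Minkowski difference). $\mathcal{C}^{\#}:=\{f\in X^*: f(x)>0\ \forall x\in\mathcal{C},\ x\neq0_X\}$ and $\mathcal{C}^{a\#}_+:=\{(f,\alpha)\in\mathcal{C}^{\#}\times(0,\infty): f(x)-\alpha\|x\|>0\ \forall x\in\mathcal{C},\ x\neq0_X\}$. *)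

theory Defs
  imports "HOL-Analysis.Analysis"
begin

text \<open>
  Throughout, \<open>S + T\<close> on sets is the Minkowski sum, whereas \<open>S - T\<close> and \<open>- S\<close> on sets mean
  difference and complement in HOL; Minkowski differences and reflections are therefore written
  with comprehensions and \<open>uminus ` S\<close>.
\<close>

text \<open>The library predicate \<^const>\<open>cone\<close> also holds of the empty set; here pointedness excludes it.\<close>

definition ordering_cone :: "'a::real_normed_vector set \<Rightarrow> bool" where
  "ordering_cone C \<longleftrightarrow>
     cone C \<and> convex C \<and> C \<noteq> {0} \<and> C \<noteq> UNIV \<and> uminus ` C \<inter> C = {0}"

definition cone_base :: "'a::real_normed_vector set \<Rightarrow> 'a set \<Rightarrow> bool" where
  "cone_base C B \<longleftrightarrow>
     B \<noteq> {} \<and> convex B \<and> B \<subseteq> C \<and> 0 \<notin> closure B \<and>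
     (\<forall>x\<in>C. x \<noteq> 0 \<longrightarrow>
        (\<exists>!p :: real \<times> 'a. fst p > 0 \<and> snd p \<in> B \<and> x = fst p *\<^sub>R snd p))"

definition weak_topology :: "'a::real_normed_vector topology" where
  "weak_topology =
     topology_generated_by {blinfun_apply f -` U |(f :: 'a \<Rightarrow>\<^sub>L real) U. open U}"

definition has_weakly_compact_base :: "'a::real_normed_vector set \<Rightarrow> bool" where
  "has_weakly_compact_base C \<longleftrightarrow> (\<exists>B. cone_base C B \<and> compactin weak_topology B)"

definition starshaped_at :: "'a::real_vector set \<Rightarrow> 'a \<Rightarrow> bool" where
  "starshaped_at S x0 \<longleftrightarrow>
     x0 \<in> S \<and> (\<forall>x\<in>S. \<forall>t\<in>{0..1::real}. t *\<^sub>R x + (1 - t) *\<^sub>R x0 \<in> S)"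

definition contingent_cone :: "'a::real_normed_vector set \<Rightarrow> 'a \<Rightarrow> 'a set" where
  "contingent_cone S x =
     {v. \<exists>(l :: nat \<Rightarrow> real) (s :: nat \<Rightarrow> 'a).
           (\<forall>n. l n > 0) \<and> (\<forall>n. s n \<in> S) \<and> s \<longlonglongrightarrow> x \<and>
           (\<lambda>n. l n *\<^sub>R (s n - x)) \<longlonglongrightarrow> v}"

text \<open>Tangentially Borwein proper efficient points of \<open>A\<close>.\<close>

definition TBo :: "'a::real_normed_vector set \<Rightarrow> 'a set \<Rightarrow> 'a set" where
  "TBo A C = {x0 \<in> A. contingent_cone (A + C) x0 \<inter> uminus ` C = {0}}"

definition cone_wedge :: "'a::real_normed_vector set \<Rightarrow> 'a set" where
  "cone_wedge C = convex hull (C \<inter> sphere 0 1)"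

definition cone_vee :: "'a::real_normed_vector set \<Rightarrow> 'a set" where
  "cone_vee C = convex hull (insert 0 (frontier C \<inter> sphere 0 1))"

text \<open>
  Strict separation property. The definition makes sense for arbitrary sets; in particular it does
  not require the second cone to be proper.
\<close>

definition SSP :: "'a::real_normed_vector set \<Rightarrow> 'a set \<Rightarrow> bool" where
  "SSP C K \<longleftrightarrow> 0 \<notin> closure {u - v |u v. u \<in> cone_wedge C \<and> v \<in> cone_vee K}"

definition strict_dual_cone :: "'a::real_normed_vector set \<Rightarrow> ('a \<Rightarrow>\<^sub>L real) set" where
  "strict_dual_cone C = {f. \<forall>x\<in>C. x \<noteq> 0 \<longrightarrow> blinfun_apply f x > 0}"

definition augmented_dual_cone ::
    "'a::real_normed_vector set \<Rightarrow> (('a \<Rightarrow>\<^sub>L real) \<times> real) set" where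
  "augmented_dual_cone C =
     {(f, \<alpha>). f \<in> strict_dual_cone C \<and> \<alpha> > 0 \<and>
               (\<forall>x\<in>C. x \<noteq> 0 \<longrightarrow> blinfun_apply f x - \<alpha> * norm x > 0)}"

end

theory Submission
  imports Defs
begin

text \<open>
  Separating the two convex sets in (SSP) yields \<open>(f, \<alpha>)\<close> such that \<open>g x = f x + \<alpha> * norm x\<close> is
  negative on \<open>- C\<close> and positive on the frontier of \<open>K\<close>, the closed cone generated by
  \<open>A - x0 + C\<close> (always away from \<open>0\<close>). The set of nonzero \<open>x\<close> with \<open>g x \<le> 0\<close> is convex, hence
  connected; it does not meet the frontier of \<open>K\<close> and it contains the nonzero points of \<open>- C\<close>,
  which lie outside \<open>K\<close> when \<open>x0\<close> is efficient, because \<open>K\<close> is the contingent cone by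
  starshapedness. So it is disjoint from \<open>K\<close>. Conversely, \<open>g \<ge> 0\<close> on \<open>A - x0\<close> passes to
  \<open>A - x0 + C\<close> and to its contingent cone, where it excludes \<open>- C\<close>.
\<close>

section \<open>Separation of a convex set from the origin\<close>

definition sublinear :: "('a::real_vector \<Rightarrow> real) \<Rightarrow> bool" where
  "sublinear p \<longleftrightarrow>
     (\<forall>x y. p (x + y) \<le> p x + p y) \<and> (\<forall>c x. c > 0 \<longrightarrow> p (c *\<^sub>R x) = c * p x)"

text \<open>Applying the second inequality to \<open>inverse c\<close> and the vector
  \<open>c *\<^sub>R x\<close> gives its converse. Only upper estimates remain to be shown, which
  suits functions defined as infima.\<close>

lemma sublinearI:
  assumes "\<And>x y. p (x + y) \<le> p x + p y"
    and "\<And>c x. c > 0 \<Longrightarrow> p (c *\<^sub>R x) \<le> c * p x"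
  shows "sublinear p"
proof -
  have "c * p x \<le> p (c *\<^sub>R x)" if "c > 0" for c x
    using assms(2)[of "inverse c" "c *\<^sub>R x"] that by (simp add: field_simps)
  then show ?thesis
    using assms by (auto simp: sublinear_def intro: antisym)
qed

lemma sublinear_add: "sublinear p \<Longrightarrow> p (x + y) \<le> p x + p y"
  by (simp add: sublinear_def)

lemma sublinear_scale: "sublinear p \<Longrightarrow> c > 0 \<Longrightarrow> p (c *\<^sub>R x) = c * p x"
  by (simp add: sublinear_def)

lemma sublinear_0:
  assumes "sublinear p" shows "p 0 = 0"
  using sublinear_scale[OF assms, of 2 0] by simp

lemma sublinear_uminus_le:
  assumes "sublinear p" shows "- p (- x) \<le> p x"
  using sublinear_add[OF assms, of x "- x"] sublinear_0[OF assms] by simp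

text \<open>Provides the bounds of chains for Zorn's lemma. The infimum is finite because
  \<open>- p (- x) \<le> - q (- x) \<le> q x\<close>. It is subadditive because two members of a
  chain, one used at \<open>x\<close> and one at \<open>y\<close>, both dominate a common
  member.\<close>

lemma sublinear_Inf_chain:
  fixes p :: "'a::real_vector \<Rightarrow> real"
  assumes "Q \<noteq> {}" and Q: "\<And>q. q \<in> Q \<Longrightarrow> sublinear q \<and> q \<le> p"
    and chain: "\<And>q q'. q \<in> Q \<Longrightarrow> q' \<in> Q \<Longrightarrow> q \<le> q' \<or> q' \<le> q"
  shows "sublinear (\<lambda>x. INF q\<in>Q. q x)" and "\<And>q x. q \<in> Q \<Longrightarrow> (INF q\<in>Q. q x) \<le> q x"
proof -
  have bdd: "bdd_below ((\<lambda>q. q x) ` Q)" for x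
  proof (rule bdd_belowI2[of _ "- p (- x)"])
    fix q assume "q \<in> Q"
    then show "- p (- x) \<le> q x"
      using Q[of q] sublinear_uminus_le[of q x] by (meson dual_order.trans le_fun_def neg_le_iff_le)
  qed
  show le: "(INF q\<in>Q. q x) \<le> q x" if "q \<in> Q" for q x
    using bdd that by (rule cINF_lower)
  show "sublinear (\<lambda>x. INF q\<in>Q. q x)"
  proof (rule sublinearI)
    fix x y
    have *: "(INF q\<in>Q. q (x + y)) \<le> q x + q' y" if "q \<in> Q" "q' \<in> Q" for q q'
    proof -
      obtain q'' where q'': "q'' \<in> Q" "q'' \<le> q" "q'' \<le> q'"
        using chain[of q q'] \<open>q \<in> Q\<close> \<open>q' \<in> Q\<close> by blast
      have "(INF q\<in>Q. q (x + y)) \<le> q'' (x + y)"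
        using q'' by (intro le)
      also have "\<dots> \<le> q'' x + q'' y"
        using Q q'' by (simp add: sublinear_add)
      also have "\<dots> \<le> q x + q' y"
        using q'' by (simp add: le_fun_def add_mono)
      finally show ?thesis .
    qed
    have "(INF q\<in>Q. q (x + y)) - q x \<le> (INF q\<in>Q. q y)" if "q \<in> Q" for q
      using assms(1) *[OF that] by (intro cINF_greatest) (auto simp: algebra_simps)
    then have "(INF q\<in>Q. q (x + y)) - (INF q\<in>Q. q y) \<le> (INF q\<in>Q. q x)"
      using assms(1) by (intro cINF_greatest) (auto simp: algebra_simps)
    then show "(INF q\<in>Q. q (x + y)) \<le> (INF q\<in>Q. q x) + (INF q\<in>Q. q y)"
      by simp
  next
    fix c :: real and x assume c: "c > 0"
    have "(INF q\<in>Q. q (c *\<^sub>R x)) / c \<le> (INF q\<in>Q. q x)"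
    proof (rule cINF_greatest[OF assms(1)])
      fix q assume "q \<in> Q"
      then show "(INF q\<in>Q. q (c *\<^sub>R x)) / c \<le> q x"
        using le[of q "c *\<^sub>R x"] Q[of q] c by (simp add: sublinear_scale field_simps)
    qed
    then show "(INF q\<in>Q. q (c *\<^sub>R x)) \<le> c * (INF q\<in>Q. q x)"
      using c by (simp add: field_simps)
  qed
qed

text \<open>Lowers \<open>q\<close> towards a function that is linear along \<open>y\<close>: the
  bound at \<open>t = 0\<close> gives \<open>r \<le> q\<close>, and \<open>t = 1\<close> at
  \<open>- y\<close> gives \<open>r (- y) \<le> - q y\<close>. If \<open>q\<close> is minimal, then
  \<open>r = q\<close>, so \<open>q\<close> is odd.\<close>

lemma sublinear_directional_inf:
  fixes q :: "'a::real_vector \<Rightarrow> real" and y :: 'a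
  assumes q: "sublinear q"
  defines "r \<equiv> \<lambda>x. INF t\<in>{0..}. q (x + t *\<^sub>R y) - t * q y"
  shows "sublinear r" and "\<And>x t. t \<ge> 0 \<Longrightarrow> r x \<le> q (x + t *\<^sub>R y) - t * q y"
proof -
  have scale: "q (c *\<^sub>R x) = c * q x" if "c \<ge> 0" for c x
    using that sublinear_scale[OF q] sublinear_0[OF q] by (cases "c = 0") auto
  have bdd: "bdd_below ((\<lambda>t. q (x + t *\<^sub>R y) - t * q y) ` {0..})" for x
  proof (rule bdd_belowI2[of _ "- q (- x)"])
    fix t :: real assume "t \<in> {0..}"
    then show "- q (- x) \<le> q (x + t *\<^sub>R y) - t * q y"
      using sublinear_add[OF q, of "x + t *\<^sub>R y" "- x"] scale[of t y] by simp
  qed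
  show le: "r x \<le> q (x + t *\<^sub>R y) - t * q y" if "t \<ge> 0" for x t
    unfolding r_def using bdd that by (intro cINF_lower) auto
  have ge: "b \<le> r x" if "\<And>t. t \<ge> 0 \<Longrightarrow> b \<le> q (x + t *\<^sub>R y) - t * q y" for b x
    unfolding r_def using that by (intro cINF_greatest) auto
  show "sublinear r"
  proof (rule sublinearI)
    fix x z
    have "r (x + z) - (q (x + t *\<^sub>R y) - t * q y) \<le> q (z + s *\<^sub>R y) - s * q y"
      if "t \<ge> 0" "s \<ge> 0" for t s
      using le[of "t + s" "x + z"] that sublinear_add[OF q, of "x + t *\<^sub>R y" "z + s *\<^sub>R y"]
      by (simp add: algebra_simps)
    then have "r (x + z) - r z \<le> q (x + t *\<^sub>R y) - t * q y" if "t \<ge> 0" for t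
      using ge[of "r (x + z) - (q (x + t *\<^sub>R y) - t * q y)" z] that by fastforce
    then show "r (x + z) \<le> r x + r z"
      using ge[of "r (x + z) - r z" x] by simp
  next
    fix c :: real and x assume c: "c > 0"
    have "r (c *\<^sub>R x) / c \<le> q (x + t *\<^sub>R y) - t * q y" if "t \<ge> 0" for t
      using le[of "c * t" "c *\<^sub>R x"] that c scale[of c "x + t *\<^sub>R y"]
      by (simp add: scaleR_right_distrib field_simps)
    then show "r (c *\<^sub>R x) \<le> c * r x"
      using ge[of "r (c *\<^sub>R x) / c" x] c by (simp add: field_simps)
  qed
qed

text \<open>The linear minorants are the minimal elements among the sublinear ones.\<close>

lemma sublinear_dominates_linear:
  fixes p :: "'a::real_vector \<Rightarrow> real"
  assumes p: "sublinear p"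
  obtains f where "linear f" "\<And>x. f x \<le> p x"
proof -
  define S where "S = {q. sublinear q \<and> q \<le> p}"
  \<comment> \<open>The order is reversed, so that the maximal element from Zorn's lemma is a
    minimal sublinear function.\<close>
  define R where "R = (\<lambda>q q' :: 'a \<Rightarrow> real. q' \<le> q)"
  have po: "partial_order_on S (relation_of R S)"
    by (rule partial_order_on_relation_ofI) (auto simp: R_def)
  have "\<exists>m\<in>S. \<forall>a\<in>S. R m a \<longrightarrow> a = m"
  proof (rule predicate_Zorn[OF po])
    fix Q assume Q: "Q \<in> Chains (relation_of R S)"
    then have sub: "q \<in> S" if "q \<in> Q" for q
      using that by (auto simp: Chains_def relation_of_def)
    have ch: "q \<le> q' \<or> q' \<le> q" if "q \<in> Q" "q' \<in> Q" for q q'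
      using Q that by (auto simp: Chains_def relation_of_def R_def)
    show "\<exists>u\<in>S. \<forall>a\<in>Q. R a u"
    proof (cases "Q = {}")
      case True
      then show ?thesis using p by (auto simp: S_def)
    next
      case False
      note inf = sublinear_Inf_chain[of Q p, OF False _ ch]
      have 1: "sublinear (\<lambda>x. INF q\<in>Q. q x)"
        and 2: "\<And>q. q \<in> Q \<Longrightarrow> (\<lambda>x. INF q\<in>Q. q x) \<le> q"
        using inf sub by (auto simp: S_def le_fun_def)
      obtain q where "q \<in> Q" using False by blast
      then have "(\<lambda>x. INF q\<in>Q. q x) \<in> S"
        using 1 2[of q] sub[of q] by (auto simp: S_def)
      with 2 show ?thesis by (auto simp: R_def)
    qed
  qed
  then obtain f where f: "sublinear f" "f \<le> p"
    and min: "\<And>q. sublinear q \<Longrightarrow> q \<le> f \<Longrightarrow> q = f"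
    by (auto simp: S_def R_def intro: order_trans)
  have neg: "f (- y) = - f y" for y
  proof -
    define r where "r = (\<lambda>x. INF t\<in>{0..}. f (x + t *\<^sub>R y) - t * f y)"
    have r: "sublinear r" "\<And>x t. t \<ge> 0 \<Longrightarrow> r x \<le> f (x + t *\<^sub>R y) - t * f y"
      unfolding r_def by (fact sublinear_directional_inf[OF f(1)])+
    have "r = f"
      using r(2)[of 0] by (intro min r(1)) (auto simp: le_fun_def)
    then have "f (- y) \<le> - f y"
      using r(2)[of 1 "- y"] sublinear_0[OF f(1)] by simp
    then show ?thesis
      using sublinear_uminus_le[OF f(1), of "- y"] by simp
  qed
  \<comment> \<open>For an odd \<open>f\<close>, subadditivity applied to
    \<open>x = (x + y) + (- y)\<close> gives the missing inequality.\<close>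
  have add: "f (x + y) = f x + f y" for x y
    using sublinear_add[OF f(1), of x y] sublinear_add[OF f(1), of "x + y" "- y"] neg[of y] by simp
  have "f (c *\<^sub>R x) = c * f x" for c x
  proof (cases c "0 :: real" rule: linorder_cases)
    case less
    then show ?thesis
      using sublinear_scale[OF f(1), of "- c" x] neg[of "c *\<^sub>R x"] by simp
  qed (auto simp: sublinear_scale[OF f(1)] sublinear_0[OF f(1)])
  then have "linear f"
    by (intro linearI) (auto simp: add)
  with f(2) that show ?thesis by (auto simp: le_fun_def)
qed

text \<open>A Hahn-Banach argument with the minorant built in. The function \<open>p\<close> below
  is sublinear because \<open>D\<close> is convex, and a linear \<open>f \<le> p\<close> does
  everything: \<open>p \<le> norm\<close> makes \<open>f\<close> continuous, and
  \<open>p (- d) \<le> - r\<close> gives \<open>r \<le> f d\<close>.\<close>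

lemma separate_convex_from_0:
  fixes D :: "'a::real_normed_vector set"
  assumes D: "convex D" and "0 \<notin> closure D"
  obtains f :: "'a \<Rightarrow>\<^sub>L real" and r where "r > 0" "\<And>d. d \<in> D \<Longrightarrow> r \<le> blinfun_apply f d"
proof (cases "D = {}")
  case True
  then show ?thesis using that[of 1] by auto
next
  case ne: False
  obtain r where r: "r > 0" and Dr: "\<And>d. d \<in> D \<Longrightarrow> r \<le> norm d"
    using assms(2) by (auto simp: closure_approachable not_less)
  define I where "I = {0::real..} \<times> D"
  define h where "h = (\<lambda>(x :: 'a) (t, d). norm (x + t *\<^sub>R d) - t * r)"
  define p where "p = (\<lambda>x. INF i\<in>I. h x i)"
  have I: "I \<noteq> {}" using ne by (auto simp: I_def)
  \<comment> \<open>This is where the distance \<open>r\<close> of \<open>D\<close> from the origin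
    enters: it keeps the infimum \<open>p\<close> finite.\<close>
  have lower: "- norm x \<le> h x i" if "i \<in> I" for x i
  proof -
    obtain t d where i: "i = (t, d)" "t \<ge> 0" "d \<in> D"
      using \<open>i \<in> I\<close> by (auto simp: I_def)
    have "t * r \<le> norm (t *\<^sub>R d)"
      using i Dr by (simp add: mult_left_mono)
    also have "\<dots> \<le> norm (x + t *\<^sub>R d) + norm x"
      using norm_triangle_ineq4[of "x + t *\<^sub>R d" x] by simp
    finally show ?thesis by (simp add: h_def i)
  qed
  have le: "p x \<le> norm (x + t *\<^sub>R d) - t * r" if "t \<ge> 0" "d \<in> D" for x t d
  proof -
    have "p x \<le> h x (t, d)"
      unfolding p_def using that lower
      by (intro cINF_lower bdd_belowI2[of _ "- norm x"]) (auto simp: I_def)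
    then show ?thesis by (simp add: h_def)
  qed
  have ge: "b \<le> p x" if "\<And>t d. t \<ge> 0 \<Longrightarrow> d \<in> D \<Longrightarrow> b \<le> norm (x + t *\<^sub>R d) - t * r" for b x
    unfolding p_def using I that by (intro cINF_greatest) (auto simp: I_def h_def)
  have "sublinear p"
  proof (rule sublinearI)
    fix x y
    have *: "p (x + y) - (norm (x + t *\<^sub>R d) - t * r) \<le> norm (y + s *\<^sub>R e) - s * r"
      if "t \<ge> 0" "d \<in> D" "s \<ge> 0" "e \<in> D" for t d s e
    proof -
      \<comment> \<open>Convexity merges the two competitors: \<open>z\<close> is the average of
        \<open>d\<close> and \<open>e\<close> with weights \<open>t / (t + s)\<close> and
        \<open>s / (t + s)\<close>, so \<open>(t + s, z)\<close> is an admissible pair for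
        \<open>x + y\<close>. If both weights vanish, any point of \<open>D\<close> will do.\<close>
      obtain z where z: "z \<in> D" "(t + s) *\<^sub>R z = t *\<^sub>R d + s *\<^sub>R e"
      proof (cases "t + s = 0")
        case True
        then have "t = 0" "s = 0" using \<open>t \<ge> 0\<close> \<open>s \<ge> 0\<close> by auto
        then show ?thesis using that[of d] \<open>d \<in> D\<close> by auto
      next
        case False
        then show ?thesis
          using that[of "(t / (t + s)) *\<^sub>R d + (s / (t + s)) *\<^sub>R e"] \<open>t \<ge> 0\<close> \<open>s \<ge> 0\<close>
            convexD[OF D \<open>d \<in> D\<close> \<open>e \<in> D\<close>, of "t / (t + s)" "s / (t + s)"]
          by (simp add: scaleR_right_distrib add_divide_distrib[symmetric])
      qed
      have "p (x + y) \<le> norm ((x + y) + (t + s) *\<^sub>R z) - (t + s) * r"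
        using that z by (intro le) auto
      also have "(x + y) + (t + s) *\<^sub>R z = (x + t *\<^sub>R d) + (y + s *\<^sub>R e)"
        by (simp add: z)
      finally show ?thesis
        using norm_triangle_ineq[of "x + t *\<^sub>R d" "y + s *\<^sub>R e"] by (simp add: algebra_simps)
    qed
    have "p (x + y) - p y \<le> norm (x + t *\<^sub>R d) - t * r" if "t \<ge> 0" "d \<in> D" for t d
      using ge[of "p (x + y) - (norm (x + t *\<^sub>R d) - t * r)" y] *[OF that] by simp
    then show "p (x + y) \<le> p x + p y"
      using ge[of "p (x + y) - p y" x] by simp
  next
    fix c :: real and x assume c: "c > 0"
    have "p (c *\<^sub>R x) / c \<le> norm (x + t *\<^sub>R d) - t * r" if "t \<ge> 0" "d \<in> D" for t d
    proof -
      have "p (c *\<^sub>R x) \<le> norm (c *\<^sub>R x + (c * t) *\<^sub>R d) - (c * t) * r"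
        using that c by (intro le) auto
      also have "c *\<^sub>R x + (c * t) *\<^sub>R d = c *\<^sub>R (x + t *\<^sub>R d)"
        by (simp add: scaleR_right_distrib)
      also have "norm \<dots> = c * norm (x + t *\<^sub>R d)"
        using c by (simp only: norm_scaleR abs_of_pos)
      finally show ?thesis
        using c by (simp add: field_simps)
    qed
    then show "p (c *\<^sub>R x) \<le> c * p x"
      using ge[of "p (c *\<^sub>R x) / c" x] c by (simp add: field_simps)
  qed
  then obtain f where f: "linear f" "\<And>x. f x \<le> p x"
    using sublinear_dominates_linear by blast
  have norm: "f x \<le> norm x" for x
    using f(2)[of x] le[of 0 _ x] ne by force
  have "\<bar>f x\<bar> \<le> norm x" for x
    using norm[of x] norm[of "- x"] linear_neg[OF f(1), of x] by simp
  then have "bounded_linear f"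
    using f(1) by (intro bounded_linear_intro[where K = 1])
      (auto simp: linear_add linear_scale)
  then have "blinfun_apply (Blinfun f) = f"
    by (rule bounded_linear_Blinfun_apply)
  moreover have "r \<le> f d" if "d \<in> D" for d
    using f(2)[of "- d"] le[of 1 d "- d"] that linear_neg[OF f(1), of d] by simp
  ultimately show ?thesis
    using that[of r "Blinfun f"] r by simp
qed

section \<open>Cones\<close>

text \<open>Multiplication by \<open>c > 0\<close> preserves both \<open>K\<close> and its
  complement, so points straddling the frontier within \<open>e / c\<close> of \<open>x\<close> are
  carried to points straddling it within \<open>e\<close> of the image. This allows frontier points
  to be normalized.\<close>

lemma cone_frontier_scaleR:
  fixes K :: "'a::real_normed_vector set"
  assumes "cone K" and "x \<in> frontier K" and "c > 0"
  shows "c *\<^sub>R x \<in> frontier K"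
  unfolding frontier_straddle
proof (intro allI impI)
  fix e :: real assume "e > 0"
  then obtain y z where yz: "y \<in> K" "dist x y < e / c" "z \<notin> K" "dist x z < e / c"
    using assms unfolding frontier_straddle by (meson divide_pos_pos)
  have scale: "dist (c *\<^sub>R x) (c *\<^sub>R w) < e" if "dist x w < e / c" for w
  proof -
    have "dist (c *\<^sub>R x) (c *\<^sub>R w) = c * dist x w"
      using \<open>c > 0\<close> by (simp add: dist_norm flip: scaleR_right_diff_distrib)
    then show ?thesis using that \<open>c > 0\<close> by (simp add: field_simps)
  qed
  have "c *\<^sub>R y \<in> K"
    using assms yz by (simp add: cone_def)
  moreover have "c *\<^sub>R z \<notin> K"
    using mem_cone[OF assms(1), of "c *\<^sub>R z" "inverse c"] yz(3) \<open>c > 0\<close> by auto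
  ultimately show "(\<exists>y\<in>K. dist (c *\<^sub>R x) y < e) \<and> (\<exists>z. z \<notin> K \<and> dist (c *\<^sub>R x) z < e)"
    using scale yz by blast
qed

text \<open>Each \<open>s\<close> in \<open>S\<close> may be moved along its segment to
  \<open>x0 + t *\<^sub>R (s - x0)\<close> with small \<open>t > 0\<close>; dividing the multiplier
  by \<open>t\<close> leaves the product unchanged. So any sequence in the cone can be rewritten
  with base points tending to \<open>x0\<close>.\<close>

lemma closure_cone_hull_subset_contingent_cone:
  fixes S :: "'a::real_normed_vector set"
  assumes S: "starshaped_at S x0"
  shows "closure (cone hull ((\<lambda>s. s - x0) ` S)) \<subseteq> contingent_cone S x0"
proof
  fix v assume "v \<in> closure (cone hull ((\<lambda>s. s - x0) ` S))"
  then obtain w where w: "\<And>n. w n \<in> cone hull ((\<lambda>s. s - x0) ` S)" "w \<longlonglongrightarrow> v"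
    unfolding closure_sequential by blast
  have "\<exists>l s. l > 0 \<and> s \<in> S \<and> w n = l *\<^sub>R (s - x0)" for n
  proof -
    obtain c s where cs: "c \<ge> 0" "s \<in> S" "w n = c *\<^sub>R (s - x0)"
      using w(1)[of n] unfolding cone_hull_expl by blast
    show ?thesis
    proof (cases "c = 0")
      \<comment> \<open>The contingent cone asks for positive multipliers, so the zero vector is
        written as \<open>1 *\<^sub>R (x0 - x0)\<close>.\<close>
      case True
      then show ?thesis
        using cs S by (intro exI[of _ 1] exI[of _ x0]) (auto simp: starshaped_at_def)
    next
      case False
      then show ?thesis
        using cs by (intro exI[of _ c] exI[of _ s]) auto
    qed
  qed
  then have "\<forall>n. \<exists>l s. l > 0 \<and> s \<in> S \<and> w n = l *\<^sub>R (s - x0)"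
    by simp
  then obtain l s where ls: "\<And>n. l n > 0" "\<And>n. s n \<in> S" "\<And>n. w n = l n *\<^sub>R (s n - x0)"
    unfolding choice_iff by blast
  \<comment> \<open>The summand 1 ensures \<open>t n \<le> 1\<close>, as starshapedness requires;
    the norm ensures that the moved point lies within \<open>1 / (n + 1)\<close> of
    \<open>x0\<close>.\<close>
  define d where "d = (\<lambda>n. 1 + norm (s n - x0))"
  define t where "t = (\<lambda>n. inverse (real (Suc n)) / d n)"
  have d: "d n \<ge> 1" for n by (simp add: d_def)
  have t: "0 < t n" "t n \<le> 1" for n
  proof -
    have "inverse (real (Suc n)) \<le> d n"
      using d[of n] order_trans[of "inverse (real (Suc n))" 1 "d n"] by (simp add: field_simps)
    then show "0 < t n" "t n \<le> 1"
      using d[of n] by (simp_all add: t_def)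
  qed
  have "norm (t n *\<^sub>R (s n - x0)) \<le> inverse (real (Suc n))" for n
  proof -
    have "norm (t n *\<^sub>R (s n - x0)) = inverse (real (Suc n)) * (norm (s n - x0) / d n)"
      using t[of n] d[of n] by (simp add: t_def)
    also have "\<dots> \<le> inverse (real (Suc n)) * 1"
      using d[of n] by (intro mult_left_mono) (auto simp: d_def divide_le_eq_1 add_pos_nonneg)
    finally show ?thesis by simp
  qed
  then have "(\<lambda>n. t n *\<^sub>R (s n - x0)) \<longlonglongrightarrow> 0"
    by (intro Lim_null_comparison[OF _ LIMSEQ_inverse_real_of_nat] always_eventually) blast
  then have "(\<lambda>n. x0 + t n *\<^sub>R (s n - x0)) \<longlonglongrightarrow> x0"
    using tendsto_add[OF tendsto_const[of x0]] by force
  moreover have "x0 + t n *\<^sub>R (s n - x0) \<in> S" for n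
  proof -
    have "t n *\<^sub>R s n + (1 - t n) *\<^sub>R x0 \<in> S"
      using S ls(2) t[of n] by (auto simp: starshaped_at_def)
    then show ?thesis by (simp add: algebra_simps)
  qed
  moreover have "(\<lambda>n. (l n / t n) *\<^sub>R (x0 + t n *\<^sub>R (s n - x0) - x0)) = w"
    using t(1) ls(3) by (auto simp: less_imp_neq[symmetric])
  ultimately show "v \<in> contingent_cone S x0"
    unfolding contingent_cone_def using ls(1) t(1) w(2)
    by (intro CollectI exI[of _ "\<lambda>n. l n / t n"] exI[of _ "\<lambda>n. x0 + t n *\<^sub>R (s n - x0)"]) auto
qed

lemma zero_in_contingent_cone: "x0 \<in> S \<Longrightarrow> 0 \<in> contingent_cone S x0"
  unfolding contingent_cone_def
  by (intro CollectI exI[of _ "\<lambda>_. 1"] exI[of _ "\<lambda>_. x0"]) auto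

section \<open>Conic separation\<close>

text \<open>Separation leaves a gap of width at least \<open>r\<close> between the values of
  \<open>f\<close> on unit vectors of \<open>C\<close> and those of \<open>- f\<close> on unit
  frontier vectors of \<open>K\<close>. Any \<alpha> strictly inside the gap works on both sides,
  first on the unit sphere and then everywhere by homogeneity.\<close>

lemma SSP_imp_augmented_functional:
  fixes C K :: "'a::real_normed_vector set"
  assumes C: "cone C" "\<exists>c\<in>C. c \<noteq> 0" and K: "cone K" and ssp: "SSP (uminus ` C) K"
  obtains f \<alpha> where "(f, \<alpha>) \<in> augmented_dual_cone C"
    and "\<And>v. v \<in> frontier K \<Longrightarrow> v \<noteq> 0 \<Longrightarrow> blinfun_apply f v + \<alpha> * norm v > 0"
proof -
  define D where "D = {u - v |u v. u \<in> cone_wedge (uminus ` C) \<and> v \<in> cone_vee K}"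
  have "D = (\<Union>u\<in>cone_wedge (uminus ` C). \<Union>v\<in>cone_vee K. {u - v})"
    by (auto simp: D_def)
  then have "convex D"
    using convex_differences[of "cone_wedge (uminus ` C)" "cone_vee K"]
    by (simp add: cone_wedge_def cone_vee_def convex_convex_hull)
  moreover have "0 \<notin> closure D"
    using ssp by (simp add: SSP_def D_def)
  ultimately obtain g :: "'a \<Rightarrow>\<^sub>L real" and r where r: "r > 0" "\<And>d. d \<in> D \<Longrightarrow> r \<le> blinfun_apply g d"
    using separate_convex_from_0 by blast
  \<comment> \<open>The sign compensates for the reflection of \<open>C\<close>: on
    \<open>- c - v\<close> the functional \<open>g\<close> takes the value
    \<open>f c + f v\<close>.\<close>
  define f where "f = - g"
  have scale: "c *\<^sub>R x \<in> C" if "x \<in> C" "c \<ge> 0" for c x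
    using C that by (simp add: cone_def)
  have *: "r - blinfun_apply f v \<le> blinfun_apply f c"
    if "c \<in> C" "norm c = 1" "v = 0 \<or> v \<in> frontier K \<and> norm v = 1" for c v
  proof -
    have "- c \<in> cone_wedge (uminus ` C)"
      unfolding cone_wedge_def using that by (intro hull_inc) auto
    moreover have "v \<in> cone_vee K"
      unfolding cone_vee_def using that by (intro hull_inc) auto
    ultimately have "- c - v \<in> D" by (auto simp: D_def)
    from r(2)[OF this] show ?thesis
      by (simp add: f_def blinfun.bilinear_simps)
  qed
  define m where "m = (INF c\<in>C \<inter> sphere 0 1. blinfun_apply f c)"
  obtain c0 where "c0 \<in> C" "c0 \<noteq> 0" using C by blast
  then have ne: "(1 / norm c0) *\<^sub>R c0 \<in> C \<inter> sphere 0 1"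
    using scale by simp
  have mge: "r - blinfun_apply f v \<le> m" if "v = 0 \<or> v \<in> frontier K \<and> norm v = 1" for v
    unfolding m_def using ne * that by (intro cINF_greatest) auto
  have mle: "m \<le> blinfun_apply f c" if "c \<in> C" "norm c = 1" for c
    unfolding m_def using *[of _ 0] that
    by (intro cINF_lower bdd_belowI2[of _ r]) (auto simp: blinfun.bilinear_simps)
  \<comment> \<open>By \<open>mle\<close> and \<open>mge\<close> the gap contains the interval from
    \<open>m - r\<close> to \<open>m\<close>, and \<alpha> is its midpoint. The origin adjoined in
    \<open>cone_vee\<close> allows \<open>v = 0\<close> in \<open>mge\<close>, whence
    \<open>m \<ge> r\<close> and \<open>\<alpha> > 0\<close>.\<close>
  define \<alpha> where "\<alpha> = m - r / 2"
  have alpha: "\<alpha> > 0"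
    using mge[of 0] r(1) by (simp add: \<alpha>_def blinfun.bilinear_simps)
  have pos: "blinfun_apply f x - \<alpha> * norm x > 0" if "x \<in> C" "x \<noteq> 0" for x
  proof -
    have "\<alpha> < blinfun_apply f ((1 / norm x) *\<^sub>R x)"
      using mle[of "(1 / norm x) *\<^sub>R x"] scale[of x "1 / norm x"] that r(1) by (simp add: \<alpha>_def)
    then show ?thesis
      using that by (simp add: blinfun.bilinear_simps field_simps)
  qed
  have "blinfun_apply f x > 0" if "x \<in> C" "x \<noteq> 0" for x
  proof -
    have "0 < \<alpha> * norm x" using alpha that by simp
    then show ?thesis using pos[OF that] by linarith
  qed
  then have "(f, \<alpha>) \<in> augmented_dual_cone C"
    using alpha pos by (auto simp: augmented_dual_cone_def strict_dual_cone_def)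
  moreover have "blinfun_apply f v + \<alpha> * norm v > 0" if "v \<in> frontier K" "v \<noteq> 0" for v
  proof -
    have "- \<alpha> < blinfun_apply f ((1 / norm v) *\<^sub>R v)"
      using mge[of "(1 / norm v) *\<^sub>R v"] cone_frontier_scaleR[OF K that(1), of "1 / norm v"] that r(1)
      by (simp add: \<alpha>_def)
    then show ?thesis
      using that by (simp add: blinfun.bilinear_simps field_simps)
  qed
  ultimately show ?thesis using that by blast
qed

text \<open>The point \<open>z\<close> certifies that the connected set \<open>N\<close> leaves
  \<open>K\<close>; a point of \<open>N\<close> inside \<open>K\<close> would then force
  \<open>N\<close> to cross the frontier, where positivity forbids it.\<close>

lemma positive_on_cone_if_positive_on_frontier:
  fixes K :: "'a::real_normed_vector set" and f :: "'a \<Rightarrow>\<^sub>L real"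
  assumes "\<alpha> > 0"
    and frontier: "\<And>v. v \<in> frontier K \<Longrightarrow> v \<noteq> 0 \<Longrightarrow> blinfun_apply f v + \<alpha> * norm v > 0"
    and z: "z \<noteq> 0" "z \<notin> K" "blinfun_apply f z + \<alpha> * norm z \<le> 0"
    and x: "x \<in> K" "x \<noteq> 0"
  shows "blinfun_apply f x + \<alpha> * norm x > 0"
proof (rule ccontr)
  define N where "N = {x. x \<noteq> 0 \<and> blinfun_apply f x + \<alpha> * norm x \<le> 0}"
  assume "\<not> ?thesis"
  then have "x \<in> N" using x by (simp add: N_def)
  \<comment> \<open>Strict negativity of \<open>f\<close> survives convex combinations and excludes
    the origin, so removing 0 from \<open>N\<close> does not destroy convexity.\<close>
  have N_neg: "N = {x. x \<noteq> 0 \<and> blinfun_apply f x + \<alpha> * norm x \<le> 0 \<and> blinfun_apply f x < 0}"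
  proof -
    have "blinfun_apply f y < 0" if "y \<noteq> 0" "blinfun_apply f y + \<alpha> * norm y \<le> 0" for y
    proof -
      have "0 < \<alpha> * norm y" using assms(1) that by simp
      then show ?thesis using that by linarith
    qed
    then show ?thesis by (auto simp: N_def)
  qed
  have "convex N"
  proof (rule convexI)
    fix a b and u v :: real
    assume ab: "a \<in> N" "b \<in> N" and uv: "0 \<le> u" "0 \<le> v" "u + v = 1"
    have "blinfun_apply f (u *\<^sub>R a + v *\<^sub>R b) < 0"
    proof (cases "u = 0")
      case True
      then show ?thesis using ab uv by (simp add: N_neg)
    next
      case False
      then have "u * blinfun_apply f a < 0" "v * blinfun_apply f b \<le> 0"
        using ab uv by (auto simp: N_neg mult_less_0_iff mult_le_0_iff)
      then show ?thesis by (simp add: blinfun.bilinear_simps)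
    qed
    moreover have "blinfun_apply f (u *\<^sub>R a + v *\<^sub>R b) + \<alpha> * norm (u *\<^sub>R a + v *\<^sub>R b) \<le> 0"
    proof -
      have "norm (u *\<^sub>R a + v *\<^sub>R b) \<le> u * norm a + v * norm b"
        using norm_triangle_ineq[of "u *\<^sub>R a" "v *\<^sub>R b"] uv by simp
      then have "\<alpha> * norm (u *\<^sub>R a + v *\<^sub>R b) \<le> \<alpha> * (u * norm a + v * norm b)"
        using assms(1) by simp
      moreover have "u * (blinfun_apply f a + \<alpha> * norm a) \<le> 0" "v * (blinfun_apply f b + \<alpha> * norm b) \<le> 0"
        using ab uv by (auto simp: N_def mult_le_0_iff)
      ultimately show ?thesis
        by (simp add: blinfun.bilinear_simps algebra_simps)
    qed
    ultimately show "u *\<^sub>R a + v *\<^sub>R b \<in> N"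
      unfolding N_neg by (metis (mono_tags, lifting) blinfun.zero_right less_irrefl mem_Collect_eq)
  qed
  moreover have "N \<inter> K \<noteq> {}" "N - K \<noteq> {}"
    using \<open>x \<in> N\<close> x z by (auto simp: N_def)
  ultimately have "N \<inter> frontier K \<noteq> {}"
    by (intro connected_Int_frontier convex_connected)
  then show False
    using frontier by (force simp: N_def)
qed

section \<open>Proper efficiency\<close>

text \<open>Adding \<open>c\<close> from \<open>C\<close> raises \<open>f\<close> by at least
  \<open>\<alpha> * norm c\<close>, while the norm term drops by at most that amount, so the bound
  passes from \<open>A\<close> to \<open>A + C\<close>. Positive homogeneity and continuity carry it
  to the tangent directions.\<close>

lemma contingent_cone_nonneg:
  fixes f :: "'a::real_normed_vector \<Rightarrow>\<^sub>L real"
  assumes aug: "(f, \<alpha>) \<in> augmented_dual_cone C"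
    and A: "\<And>x. x \<in> A \<Longrightarrow> 0 \<le> blinfun_apply f (x - x0) + \<alpha> * norm (x - x0)"
    and v: "v \<in> contingent_cone (A + C) x0"
  shows "0 \<le> blinfun_apply f v + \<alpha> * norm v"
proof -
  have nonneg: "0 \<le> blinfun_apply f (s - x0) + \<alpha> * norm (s - x0)" if "s \<in> A + C" for s
  proof -
    obtain a c where s: "s = a + c" "a \<in> A" "c \<in> C"
      using \<open>s \<in> A + C\<close> by (auto simp: set_plus_def)
    have "\<alpha> > 0" "blinfun_apply f c \<ge> \<alpha> * norm c"
      using aug s(3) by (cases "c = 0"; force simp: augmented_dual_cone_def blinfun.bilinear_simps)+
    moreover have "norm (a - x0) \<le> norm (s - x0) + norm c"
      using norm_triangle_ineq4[of "s - x0" c] by (simp add: s algebra_simps)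
    then have "\<alpha> * norm (a - x0) \<le> \<alpha> * norm (s - x0) + \<alpha> * norm c"
      using \<open>\<alpha> > 0\<close> by (simp flip: distrib_left)
    moreover have "blinfun_apply f (s - x0) = blinfun_apply f (a - x0) + blinfun_apply f c"
      by (simp add: s blinfun.bilinear_simps)
    ultimately show ?thesis
      using A[OF s(2)] by linarith
  qed
  obtain l s where ls: "\<And>n::nat. l n > 0" "\<And>n. s n \<in> A + C"
    and lim: "(\<lambda>n. l n *\<^sub>R (s n - x0)) \<longlonglongrightarrow> v"
    using v by (auto simp: contingent_cone_def)
  have "(\<lambda>n. blinfun_apply f (l n *\<^sub>R (s n - x0)) + \<alpha> * norm (l n *\<^sub>R (s n - x0)))
      \<longlonglongrightarrow> blinfun_apply f v + \<alpha> * norm v"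
    using lim by (intro tendsto_intros)
  moreover have "0 \<le> blinfun_apply f (l n *\<^sub>R (s n - x0)) + \<alpha> * norm (l n *\<^sub>R (s n - x0))" for n
  proof -
    have "0 \<le> l n * (blinfun_apply f (s n - x0) + \<alpha> * norm (s n - x0))"
      using ls(1)[of n] nonneg[OF ls(2)] by (intro mult_nonneg_nonneg) auto
    then show ?thesis
      using ls(1)[of n] by (simp add: blinfun.scaleR_right distrib_left mult.left_commute)
  qed
  ultimately show ?thesis
    by (intro LIMSEQ_le_const) auto
qed

theorem corollary3p11:
  fixes A C :: "'a::real_normed_vector set" and x0 :: 'a
  assumes "ordering_cone C"
    and "x0 \<in> A"
    and "starshaped_at (A + C) x0"
    and "has_weakly_compact_base C"
    and "SSP (uminus ` C) (closure (cone hull ((\<lambda>a. a - x0) ` A + C)))"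
  shows "x0 \<in> TBo A C \<longleftrightarrow>
    (\<exists>(f, \<alpha>) \<in> augmented_dual_cone C.
       {x. is_arg_min (\<lambda>x. blinfun_apply f (x - x0) + \<alpha> * norm (x - x0)) (\<lambda>x. x \<in> A) x} = {x0})"
proof
  define K where "K = closure (cone hull ((\<lambda>a. a - x0) ` A + C))"
  have C: "cone C" "0 \<in> C" "\<exists>c\<in>C. c \<noteq> 0"
    using assms(1) unfolding ordering_cone_def by auto
  \<comment> \<open>Translation by \<open>x0\<close> commutes with adding \<open>C\<close>, so
    \<open>K\<close> is the closed cone generated by \<open>A + C\<close> seen from its star
    centre.\<close>
  have "(\<lambda>a. a - x0) ` A + C = (\<lambda>s. s - x0) ` (A + C)"
    by (force simp: set_plus_def image_iff algebra_simps)
  then have K_sub: "K \<subseteq> contingent_cone (A + C) x0"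
    using closure_cone_hull_subset_contingent_cone[OF assms(3)] by (simp add: K_def)
  have "cone K"
    unfolding K_def by (intro cone_closure cone_cone_hull)
  assume "x0 \<in> TBo A C"
  then have disj: "contingent_cone (A + C) x0 \<inter> uminus ` C = {0}"
    by (simp add: TBo_def)
  obtain f \<alpha> where aug: "(f, \<alpha>) \<in> augmented_dual_cone C"
    and front: "\<And>v. v \<in> frontier K \<Longrightarrow> v \<noteq> 0 \<Longrightarrow> blinfun_apply f v + \<alpha> * norm v > 0"
    using SSP_imp_augmented_functional[OF C(1,3) \<open>cone K\<close>] assms(5) unfolding K_def by blast
  \<comment> \<open>Its reflection \<open>- c\<close> serves as the point outside \<open>K\<close>
    at which the augmented functional is negative.\<close>
  obtain c where c: "c \<in> C" "c \<noteq> 0" using C by blast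
  have notK: "- c \<notin> K" using disj K_sub c by (metis IntI imageI neg_equal_0_iff_equal singletonD subsetD)
  have pos: "blinfun_apply f (x - x0) + \<alpha> * norm (x - x0) > 0" if "x \<in> A" "x \<noteq> x0" for x
  proof (rule positive_on_cone_if_positive_on_frontier[OF _ front, where z = "- c"])
    have "x - x0 \<in> (\<lambda>a. a - x0) ` A + C"
      using set_plus_intro[of "x - x0" "(\<lambda>a. a - x0) ` A" 0 C] that C by auto
    then show "x - x0 \<in> K"
      unfolding K_def by (meson closure_subset hull_subset subsetD)
    show "blinfun_apply f (- c) + \<alpha> * norm (- c) \<le> 0" "\<alpha> > 0"
      using aug c by (auto simp: augmented_dual_cone_def blinfun.bilinear_simps less_imp_le)
  qed (use that c notK in auto)
  have "{x. is_arg_min (\<lambda>x. blinfun_apply f (x - x0) + \<alpha> * norm (x - x0)) (\<lambda>x. x \<in> A) x} = {x0}"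
    using pos assms(2) by (force simp: is_arg_min_def blinfun.bilinear_simps)
  with aug show "\<exists>(f, \<alpha>) \<in> augmented_dual_cone C.
      {x. is_arg_min (\<lambda>x. blinfun_apply f (x - x0) + \<alpha> * norm (x - x0)) (\<lambda>x. x \<in> A) x} = {x0}"
    by blast
next
  assume "\<exists>(f, \<alpha>) \<in> augmented_dual_cone C.
      {x. is_arg_min (\<lambda>x. blinfun_apply f (x - x0) + \<alpha> * norm (x - x0)) (\<lambda>x. x \<in> A) x} = {x0}"
  then obtain f \<alpha> where aug: "(f, \<alpha>) \<in> augmented_dual_cone C" and
    "is_arg_min (\<lambda>x. blinfun_apply f (x - x0) + \<alpha> * norm (x - x0)) (\<lambda>x. x \<in> A) x0"
    by blast
  \<comment> \<open>The objective vanishes at \<open>x0\<close>, so minimality there means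
    nonnegativity on \<open>A\<close>.\<close>
  then have A: "0 \<le> blinfun_apply f (x - x0) + \<alpha> * norm (x - x0)" if "x \<in> A" for x
    using that by (fastforce simp: is_arg_min_def blinfun.bilinear_simps not_less)
  have "v = 0" if v: "v \<in> contingent_cone (A + C) x0" "v \<in> uminus ` C" for v
  proof (rule ccontr)
    assume "v \<noteq> 0"
    \<comment> \<open>Since \<open>- v\<close> is a nonzero point of \<open>C\<close>, this says
      that \<open>f v + \<alpha> * norm v\<close> is negative.\<close>
    then have "blinfun_apply f (- v) - \<alpha> * norm (- v) > 0"
      using aug v(2) by (fastforce simp: augmented_dual_cone_def)
    then show False
      using contingent_cone_nonneg[OF aug A v(1)] by (simp add: blinfun.bilinear_simps)
  qed
  moreover have "0 \<in> uminus ` C"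
    using assms(1) by (auto simp: ordering_cone_def)
  moreover have "0 \<in> contingent_cone (A + C) x0"
    using assms(3) by (intro zero_in_contingent_cone) (simp add: starshaped_at_def)
  ultimately show "x0 \<in> TBo A C"
    using assms(2) by (auto simp: TBo_def)
qed

end
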